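(* Let $n\ge 1$, $l=\lfloor n/2\rfloor$, and let $x,y\in\mathbb{C}$. Let $J_n$ be an $n\times n$ complex irreducible tridiagonal matrix with zero main diagonal, with subdiagonal entries $a_1,\dots,a_{n-1}\in\mathbb{C}\setminus\{0\}$ and superdiagonal entries $c_1,\dots,c_{n-1}\in\mathbb{C}\setminus\{0\}$. Let $B_n$ be the tridiagonal matrix with the same sub- and superdiagonals as $J_n$ and with main diagonal entries $b_k=x$ for odd $k$ and $b_k=y$ for even $k$, $k=1,\dots,n$. Let $\lambda_1,\dots,\lambda_l\in\mathbb{C}$ be such that, as multisets (eigenvalues listed with algebraic multiplicity), $\sigma(J_n)=\{\pm\lambda_1,\dots,\pm\lambda_l\}$ if $n=2l$, and $\sigma(J_n)=\{0,\pm\lambda_1,\dots,\pm\lambda_l\}$ if $n=2l+1$. Then $$\det B_{2l}=\prod_{k=1}^{l}\left(xy-\lambda_k^2\right)\ \text{ if } n=2l,\qquad \det B_{2l+1}=x\prod_{k=1}^{l}\left(xy-\lambda_k^2\right)\ \text{ if } n=2l+1.$$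
   Context: $J_n$ has entries $(J_n)_{k+1,k}=a_k$, $(J_n)_{k,k+1}=c_k$ for $k=1,\dots,n-1$, and all other entries zero. The spectrum $\sigma(M)$ of a matrix $M$ is the multiset of its eigenvalues, each appearing as many times as its algebraic multiplicity. The spectrum of $J_n$ always admits the listing used in the claim (it is symmetric with respect to $0$); the numbers $\lambda_i$ need not be distinct, and for odd $n$ some of them may be zero. *)

theory Defs
  imports Complex_Main "HOL-Library.Multiset" "Jordan_Normal_Form.Char_Poly"
begin

(* Matrix positions are 0-based, but the coefficient sequences a, b, c are indexed from 1
   as on paper: in 1-based positions the entry at (k+1,k) is a k, at (k,k) it is b k,
   and at (k,k+1) it is c k. *)
definition tridiag ::
  "nat \<Rightarrow> (nat \<Rightarrow> 'a :: zero) \<Rightarrow> (nat \<Rightarrow> 'a) \<Rightarrow> (nat \<Rightarrow> 'a) \<Rightarrow> 'a mat" where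
  "tridiag n a b c = mat n n (\<lambda>(i, j).
     if i = j then b (Suc i)
     else if i = Suc j then a (Suc j)
     else if j = Suc i then c (Suc i)
     else 0)"

definition J_mat :: "nat \<Rightarrow> (nat \<Rightarrow> complex) \<Rightarrow> (nat \<Rightarrow> complex) \<Rightarrow> complex mat" where
  "J_mat n a c = tridiag n a (\<lambda>k. 0) c"

definition B_mat ::
  "nat \<Rightarrow> complex \<Rightarrow> complex \<Rightarrow> (nat \<Rightarrow> complex) \<Rightarrow> (nat \<Rightarrow> complex) \<Rightarrow> complex mat" where
  "B_mat n x y a c = tridiag n a (\<lambda>k. if odd k then x else y) c"

(* Unlike the set spectrum of Jordan_Normal_Form.Spectral_Radius, this counts every
   eigenvalue with its algebraic multiplicity. *)
definition spectrum_mset :: "complex mat \<Rightarrow> complex multiset" where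
  "spectrum_mset M = proots (char_poly M)"

end

(* By the three-term recurrence for continuants, det B_n = q_n(x y), times x if n is odd,
   where the polynomial q_n depends only on the products a_k c_k. The characteristic matrix
   of J_n is, up to two sign changes that cancel in these products, the case x = y = X over
   the polynomial ring, so char_poly J_n = q_n(X^2), times X if n is odd. The spectrum
   therefore determines q_n(X^2), and evaluating at a square root of x y gives the claim. *)
theory Submission
  imports Defs
begin

text \<open>Two Laplace expansions. The last row has only its two final entries possibly nonzero;
  the minor belonging to the off-diagonal one has \<open>c (Suc n)\<close> as the only possibly
  nonzero entry of its last column, so expanding along that column leaves the leading block of size
  \<open>n\<close>.\<close>

lemma det_tridiag_recurrence:
  fixes a b c :: "nat \<Rightarrow> 'a :: comm_ring_1"
  shows "det (tridiag (Suc (Suc n)) a b c) =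
    b (Suc (Suc n)) * det (tridiag (Suc n) a b c)
    - a (Suc n) * c (Suc n) * det (tridiag n a b c)"
proof -
  let ?A = "tridiag (Suc (Suc n)) a b c"
  define M where "M = mat_delete ?A (Suc n) n"
  have A: "?A \<in> carrier_mat (Suc (Suc n)) (Suc (Suc n))"
    by (simp add: tridiag_def)
  have M: "M \<in> carrier_mat (Suc n) (Suc n)"
    using mat_delete_carrier[OF A] by (simp add: M_def)
  have last_row: "?A $$ (Suc n, j) = 0" if "j < n" for j
    using that by (simp add: tridiag_def)
  have last_col: "M $$ (i, n) = 0" if "i < n" for i
    using that by (simp add: M_def mat_delete_def tridiag_def)
  have del: "mat_delete ?A (Suc n) (Suc n) = tridiag (Suc n) a b c"
    by (rule eq_matI) (auto simp: mat_delete_def tridiag_def)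
  have delM: "mat_delete M n n = tridiag n a b c"
    by (rule eq_matI) (auto simp: M_def mat_delete_def tridiag_def)
  have "det M = (\<Sum>i<Suc n. M $$ (i, n) * cofactor M i n)"
    by (rule laplace_expansion_column[OF M]) simp
  also have "\<dots> = M $$ (n, n) * cofactor M n n"
    using last_col by simp
  also have "\<dots> = c (Suc n) * det (tridiag n a b c)"
    by (simp add: cofactor_def delM) (simp add: M_def mat_delete_def tridiag_def)
  finally have detM: "det M = c (Suc n) * det (tridiag n a b c)" .
  have "det ?A = (\<Sum>j<Suc (Suc n). ?A $$ (Suc n, j) * cofactor ?A (Suc n) j)"
    by (rule laplace_expansion_row[OF A]) simp
  also have "\<dots> = ?A $$ (Suc n, n) * cofactor ?A (Suc n) n
      + ?A $$ (Suc n, Suc n) * cofactor ?A (Suc n) (Suc n)"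
    using last_row by simp
  \<comment> \<open>The indices sum to an odd number, which gives the minus sign.\<close>
  also have "cofactor ?A (Suc n) n = - det M"
    by (simp add: cofactor_def M_def)
  also have "cofactor ?A (Suc n) (Suc n) = det (tridiag (Suc n) a b c)"
    by (simp add: cofactor_def del)
  finally show ?thesis
    by (simp add: detM tridiag_def algebra_simps)
qed

text \<open>The continuant of the alternating diagonal with its factor x at odd sizes split off. A
  step to an even size multiplies y by the x split off one size earlier, giving \<open>z\<close> =
  xy; a step to an odd size has x in both terms, so its coefficient is 1.\<close>

fun reduced_continuant :: "(nat \<Rightarrow> 'a :: comm_ring_1) \<Rightarrow> 'a \<Rightarrow> nat \<Rightarrow> 'a" where
  "reduced_continuant w z 0 = 1"
| "reduced_continuant w z (Suc 0) = 1"
| "reduced_continuant w z (Suc (Suc n)) =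
     (if even n then z else 1) * reduced_continuant w z (Suc n)
     - w (Suc n) * reduced_continuant w z n"

lemma det_tridiag_alternating:
  fixes a c :: "nat \<Rightarrow> 'a :: comm_ring_1"
  shows "det (tridiag n a (\<lambda>k. if odd k then x else y) c) =
    (if odd n then x else 1) * reduced_continuant (\<lambda>k. a k * c k) (x * y) n"
proof (induction n rule: induct_nat_012)
  case 0
  have "tridiag 0 a (\<lambda>k. if odd k then x else y) c \<in> carrier_mat 0 0"
    by (simp add: tridiag_def)
  then show ?case by simp
next
  case 1
  show ?case
    by (subst det_single) (simp_all add: tridiag_def)
next
  case (ge2 n)
  then show ?case
    by (simp add: det_tridiag_recurrence algebra_simps)
qed

lemma poly_reduced_continuant:
  "poly (reduced_continuant (\<lambda>k. [:w k:]) p n) t = reduced_continuant w (poly p t) n"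
  by (induction n rule: induct_nat_012) simp_all

lemma char_poly_J_mat:
  "char_poly (J_mat n a c) =
    (if odd n then [:0, 1:] else 1) * reduced_continuant (\<lambda>k. [:a k * c k:]) [:0, 0, 1:] n"
proof -
  \<comment> \<open>The vacuous conditional exhibits the diagonal in the form of \<open>det_tridiag_alternating\<close>.\<close>
  have "char_poly_matrix (J_mat n a c) =
      tridiag n (\<lambda>k. [:- a k:]) (\<lambda>k. if odd k then [:0, 1:] else [:0, 1:]) (\<lambda>k. [:- c k:])"
    by (rule eq_matI) (auto simp: char_poly_matrix_def J_mat_def tridiag_def)
  then show ?thesis
    unfolding char_poly_def by (simp only: det_tridiag_alternating) (simp add: mult.commute)
qed

text \<open>A complex polynomial splits over its roots up to its leading coefficient, which is 1
  here.\<close>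

lemma char_poly_eq_prod_spectrum_mset:
  assumes "A \<in> carrier_mat n n"
  shows "char_poly A = (\<Prod>r\<in>#spectrum_mset A. [:- r, 1:])"
  using complex_poly_decompose_multiset[of "char_poly A"] degree_monic_char_poly[OF assms]
  by (simp add: spectrum_mset_def)

text \<open>The factors X - \<open>f k\<close> and X + \<open>f k\<close> are paired by index, not
  by value, so repeated or zero values do no harm.\<close>

lemma prod_mset_symmetric_linear_factors:
  fixes f :: "nat \<Rightarrow> 'a :: comm_ring_1"
  shows "(\<Prod>r\<in>#{#f k. k \<in># mset_set S#} + {#- f k. k \<in># mset_set S#}. [:- r, 1:]) =
    (\<Prod>k\<in>S. [:- (f k)\<^sup>2, 0, 1:])"
  by (simp add: image_mset.compositionality o_def prod_unfold_prod_mset[symmetric]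
      prod.distrib[symmetric] power2_eq_square)

theorem mainTheorem3:
  fixes n l :: nat and x y :: complex and a c lam :: "nat \<Rightarrow> complex"
  assumes "n \<ge> 1" and "l = n div 2"
    and "\<And>k. 1 \<le> k \<Longrightarrow> k \<le> n - 1 \<Longrightarrow> a k \<noteq> 0"
    and "\<And>k. 1 \<le> k \<Longrightarrow> k \<le> n - 1 \<Longrightarrow> c k \<noteq> 0"
    and "n = 2 * l \<Longrightarrow> spectrum_mset (J_mat n a c) =
           {#lam k. k \<in># mset_set {1..l}#} + {#- lam k. k \<in># mset_set {1..l}#}"
    and "n = 2 * l + 1 \<Longrightarrow> spectrum_mset (J_mat n a c) =
           {#0#} + {#lam k. k \<in># mset_set {1..l}#} + {#- lam k. k \<in># mset_set {1..l}#}"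
  shows "(n = 2 * l \<longrightarrow> det (B_mat n x y a c) = (\<Prod>k=1..l. x * y - (lam k)\<^sup>2)) \<and>
         (n = 2 * l + 1 \<longrightarrow> det (B_mat n x y a c) = x * (\<Prod>k=1..l. x * y - (lam k)\<^sup>2))"
proof -
  let ?w = "\<lambda>k. a k * c k"
  let ?P = "{#lam k. k \<in># mset_set {1..l}#} + {#- lam k. k \<in># mset_set {1..l}#}"
  let ?F = "\<Prod>k=1..l. [:- (lam k)\<^sup>2, 0, 1:]"
  have J: "J_mat n a c \<in> carrier_mat n n"
    by (simp add: J_mat_def tridiag_def)
  have "spectrum_mset (J_mat n a c) = (if odd n then {#0#} else {#}) + ?P"
    using assms(2,5,6) by (cases "odd n") (auto elim!: evenE oddE)
  then have "char_poly (J_mat n a c) = (if odd n then [:0, 1:] else 1) * ?F"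
    using prod_mset_symmetric_linear_factors[of lam "{1..l}"]
    by (simp add: char_poly_eq_prod_spectrum_mset[OF J])
  \<comment> \<open>For odd \<open>n\<close> the factor X is cancelled in the polynomial ring, an
    integral domain. Doing so before evaluation keeps the case xy = 0 from needing separate
    treatment.\<close>
  then have red: "reduced_continuant (\<lambda>k. [:?w k:]) [:0, 0, 1:] n = ?F"
    by (simp add: char_poly_J_mat split: if_splits)
  obtain t where t: "t\<^sup>2 = x * y"
    using power2_csqrt by blast
  have "reduced_continuant ?w (x * y) n = poly ?F t"
    unfolding red[symmetric] poly_reduced_continuant
    using t by (simp add: power2_eq_square)
  also have "\<dots> = (\<Prod>k=1..l. x * y - (lam k)\<^sup>2)"
    using t by (simp add: poly_prod power2_eq_square)
  finally show ?thesis
    by (auto simp: B_mat_def det_tridiag_alternating)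
qed

end
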